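(* Let $X$ be a Banach space, let $T\in B(X)$, and let $K\in B(X)$ be an algebraic operator such that $TK=KT$. If $T$ has Bishop's property $(\beta)$ at each of the zeros of $p$, where $p$ is a nonzero polynomial for which $p(K)=0$, then $T+K$ has Bishop's property $(\beta)$ at $0$. In particular, if $T$ has Bishop's property $(\beta)$, then $T+K$ has Bishop's property $(\beta)$.
   Context: $B(X)$ is the Banach algebra of all bounded linear operators on the (complex) Banach space $X$. For open $U\subset\mathbb{C}$, $O(U;X)$ is the Fréchet space of analytic $X$-valued functions on $U$, with the topology of uniform convergence on compact subsets of $U$; $D(\lambda_0;v)$ is the open disc with centre $\lambda_0\in\mathbb{C}$ and radius $v>0$. An operator $T\in B(X)$ has Bishop's property $(\beta)$ at $\lambda_0\in\mathbb{C}$ if there exists $v>0$ such that for every open subset $U\subset D(\lambda_0;v)$ and every sequence $(f_n)_{n\ge 1}\subset O(U;X)$, $\lim_{n\to\infty}(T-\lambda I)f_n(\lambda)=0$ in $O(U;X)$ implies $\lim_{n\to\infty}f_n(\lambda)=0$ in $O(U;X)$. $T$ has Bishop's property $(\beta)$ if it has it at every $\lambda_0\in\mathbb{C}$. An operator $K\in B(X)$ is algebraic if there exists a nontrivial polynomial $p$ such that $p(K)=0$.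
   Formalization: The local claim is proved for T-K at 0 instead of T+K at 0, since as printed it is false: on l^infinity, with B the backward shift, take T=B-3I, K=3I, p(z)=z-3. The "in particular" claim for T+K is unchanged. *)

theory Defs
  imports "HOL-Analysis.Analysis" "HOL-Computational_Algebra.Polynomial"
begin

text \<open>The library has real Banach spaces only. The scalar action of the complex numbers below
  extends the real one and satisfies the norm axiom, so that a type of class
  \<open>complex_banach\<close> is a complex Banach space.\<close>

class complex_banach = banach +
  fixes scaleC :: "complex \<Rightarrow> 'a \<Rightarrow> 'a"  (infixr \<open>*\<^sub>C\<close> 75)
  assumes scaleC_add_right: "a *\<^sub>C (x + y) = a *\<^sub>C x + a *\<^sub>C y"
    and scaleC_add_left: "(a + b) *\<^sub>C x = a *\<^sub>C x + b *\<^sub>C x"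
    and scaleC_scaleC: "a *\<^sub>C (b *\<^sub>C x) = (a * b) *\<^sub>C x"
    and scaleC_of_real: "complex_of_real r *\<^sub>C x = r *\<^sub>R x"
    and norm_scaleC: "norm (a *\<^sub>C x) = cmod a * norm x"

instantiation complex :: complex_banach
begin

definition scaleC_complex :: "complex \<Rightarrow> complex \<Rightarrow> complex" where
  "scaleC_complex a x = a * x"

instance
  by standard (auto simp: scaleC_complex_def algebra_simps scaleR_conv_of_real norm_mult)

end

definition bounded_clinear :: "('a::complex_banach \<Rightarrow> 'a) \<Rightarrow> bool" where
  "bounded_clinear T \<longleftrightarrow> bounded_linear T \<and> (\<forall>c x. T (c *\<^sub>C x) = c *\<^sub>C T x)"

definition op_poly :: "complex poly \<Rightarrow> ('a::complex_banach \<Rightarrow> 'a) \<Rightarrow> 'a \<Rightarrow> 'a" where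
  "op_poly p K = (\<lambda>x. \<Sum>i\<le>degree p. coeff p i *\<^sub>C (K ^^ i) x)"

definition algebraic_op :: "('a::complex_banach \<Rightarrow> 'a) \<Rightarrow> bool" where
  "algebraic_op K \<longleftrightarrow> (\<exists>p. p \<noteq> 0 \<and> op_poly p K = (\<lambda>x. 0))"

text \<open>Membership in \<open>O(U;X)\<close> for open \<open>U\<close>: the real derivative exists at every point and is
  multiplication of a fixed vector by the complex increment, i.e. \<open>f\<close> is complex
  differentiable in norm.\<close>

definition analytic_fun_on :: "(complex \<Rightarrow> 'a::complex_banach) \<Rightarrow> complex set \<Rightarrow> bool" where
  "analytic_fun_on f U \<longleftrightarrow> (\<forall>z\<in>U. \<exists>D. (f has_derivative (\<lambda>h. h *\<^sub>C D)) (at z))"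

definition tendsto_zero_in_O ::
    "complex set \<Rightarrow> (nat \<Rightarrow> complex \<Rightarrow> 'a::complex_banach) \<Rightarrow> bool" where
  "tendsto_zero_in_O U f \<longleftrightarrow>
     (\<forall>C. compact C \<and> C \<subseteq> U \<longrightarrow> uniform_limit C f (\<lambda>z. 0) sequentially)"

definition bishop_beta_at :: "('a::complex_banach \<Rightarrow> 'a) \<Rightarrow> complex \<Rightarrow> bool" where
  "bishop_beta_at T z0 \<longleftrightarrow>
     (\<exists>v>0. \<forall>U f. open U \<and> U \<subseteq> ball z0 v \<and> (\<forall>n. analytic_fun_on (f n) U) \<and>
        tendsto_zero_in_O U (\<lambda>n z. T (f n z) - z *\<^sub>C f n z)
        \<longrightarrow> tendsto_zero_in_O U f)"

definition bishop_beta :: "('a::complex_banach \<Rightarrow> 'a) \<Rightarrow> bool" where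
  "bishop_beta T \<longleftrightarrow> (\<forall>z0. bishop_beta_at T z0)"

text \<open>The localized perturbation result concerns \<open>T - K\<close> at \<open>0\<close>, not \<open>T + K\<close>: where \<open>K\<close> acts as
  a zero \<open>\<mu>\<close> of \<open>p\<close>, property \<open>(\<beta>)\<close> of \<open>T - \<mu> I\<close> at \<open>0\<close> is property \<open>(\<beta>)\<close> of \<open>T\<close> at \<open>\<mu>\<close>.
  For \<open>T + K\<close> at \<open>0\<close> the claim fails: take \<open>T = B - 3 I\<close>, \<open>K = 3 I\<close> and \<open>p(z) = z - 3\<close>, with
  \<open>B\<close> the backward shift on the bounded sequences.\<close>

end

theory Submission
  imports Defs "HOL-Computational_Algebra.Fundamental_Theorem_Algebra"
begin

text \<open>Factor \<open>p\<close> into linear factors \<open>K - \<mu> I\<close> and strip them off one at a time. If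
  \<open>(T + c K - \<lambda> I) h\<^sub>n(\<lambda>) \<rightarrow> 0\<close> and \<open>(K - \<mu> I) h\<^sub>n(\<lambda>) \<rightarrow> 0\<close>, then
  \<open>(T - (\<lambda> - c \<mu>) I) h\<^sub>n(\<lambda>) \<rightarrow> 0\<close>, and property \<open>(\<beta>)\<close> of \<open>T\<close> near \<open>w - c \<mu>\<close> gives
  \<open>h\<^sub>n \<rightarrow> 0\<close> for \<open>\<lambda>\<close> near \<open>w\<close>. The scalars \<open>c = - 1\<close> and \<open>c = 1\<close> give the two claims.\<close>

section \<open>Complex-linear bounded operators and the scalar action\<close>

lemma bounded_clinear_imp_bounded_linear: "bounded_clinear T \<Longrightarrow> bounded_linear T"
  by (simp add: bounded_clinear_def)

lemma bounded_clinear_scaleC_commute: "bounded_clinear T \<Longrightarrow> T (c *\<^sub>C x) = c *\<^sub>C T x"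
  by (simp add: bounded_clinear_def)

lemma bounded_clinear_diff: "bounded_clinear T \<Longrightarrow> T (x - y) = T x - T y"
  by (intro linear_diff bounded_linear.linear bounded_clinear_imp_bounded_linear)

lemma bounded_clinear_add: "bounded_clinear T \<Longrightarrow> T (x + y) = T x + T y"
  by (intro linear_add bounded_linear.linear bounded_clinear_imp_bounded_linear)

lemma bounded_clinear_sum: "bounded_clinear T \<Longrightarrow> T (sum f A) = (\<Sum>i\<in>A. T (f i))"
  by (intro linear_sum bounded_linear.linear bounded_clinear_imp_bounded_linear)

text \<open>Complex scalars commute, and real ones are complex ones by
  \<open>scaleC_of_real\<close>. Viewing a scalar as an operator makes every fact about
  \<open>bounded_clinear\<close> maps available for it.\<close>

lemma bounded_clinear_scaleC: "bounded_clinear ((*\<^sub>C) (c :: complex) :: 'a::complex_banach \<Rightarrow> 'a)"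
proof -
  have "c *\<^sub>C (r *\<^sub>R x) = r *\<^sub>R (c *\<^sub>C x)" for r and x :: 'a
    by (simp add: scaleC_scaleC mult.commute flip: scaleC_of_real)
  then have "bounded_linear ((*\<^sub>C) c :: 'a \<Rightarrow> 'a)"
    by (intro bounded_linear_intro[where K = "cmod c"])
       (auto simp: scaleC_add_right norm_scaleC mult.commute)
  then show ?thesis
    by (simp add: bounded_clinear_def scaleC_scaleC mult.commute)
qed

lemma scaleC_one: "1 *\<^sub>C x = (x :: 'a::complex_banach)"
  using scaleC_of_real[of 1 x] by simp

lemma scaleC_zero_left: "0 *\<^sub>C x = (0 :: 'a::complex_banach)"
  using scaleC_of_real[of 0 x] by simp

lemma scaleC_minus_left: "(- a) *\<^sub>C x = - (a *\<^sub>C (x :: 'a::complex_banach))"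
  using scaleC_add_left[of a "- a" x] by (simp add: scaleC_zero_left eq_neg_iff_add_eq_0 add.commute)

lemma scaleC_diff_left: "(a - b) *\<^sub>C x = a *\<^sub>C x - b *\<^sub>C (x :: 'a::complex_banach)"
  using scaleC_add_left[of a "- b" x] by (simp add: scaleC_minus_left)

lemmas scaleC_diff_right = bounded_clinear_diff[OF bounded_clinear_scaleC]

lemma bounded_clinear_funpow:
  assumes "bounded_clinear K"
  shows "bounded_clinear (K ^^ n)"
proof (induction n)
  case 0
  then show ?case
    by (simp add: bounded_clinear_def id_def)
next
  case (Suc n)
  then show ?case
    using assms bounded_linear_compose[of K "K ^^ n"] by (simp add: bounded_clinear_def o_def)
qed

section \<open>Polynomials of an operator\<close>

lemma bounded_clinear_op_poly:
  fixes K :: "'a::complex_banach \<Rightarrow> 'a"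
  assumes "bounded_clinear K"
  shows "bounded_clinear (op_poly p K)"
proof -
  note pow = bounded_clinear_funpow[OF assms]
  have "bounded_linear (\<lambda>x. coeff p i *\<^sub>C (K ^^ i) x)" for i
    by (rule bounded_linear_compose[OF bounded_clinear_imp_bounded_linear
          bounded_clinear_imp_bounded_linear, OF bounded_clinear_scaleC pow])
  then have "bounded_linear (op_poly p K)"
    unfolding op_poly_def by (intro bounded_linear_sum)
  then show ?thesis
    by (simp add: bounded_clinear_def op_poly_def bounded_clinear_sum[OF bounded_clinear_scaleC]
        bounded_clinear_scaleC_commute[OF pow] scaleC_scaleC mult.commute)
qed

text \<open>Coefficients beyond the degree vanish. A free upper bound lets polynomials of different
  degrees be summed over one range.\<close>

lemma op_poly_altdef:
  fixes K :: "'a::complex_banach \<Rightarrow> 'a"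
  assumes "degree p \<le> N"
  shows "op_poly p K x = (\<Sum>i\<le>N. coeff p i *\<^sub>C (K ^^ i) x)"
  unfolding op_poly_def using assms
  by (intro sum.mono_neutral_left) (auto simp: coeff_eq_0 scaleC_zero_left)

text \<open>The product is \<open>pCons 0 q\<close> minus \<open>z\<close> times \<open>q\<close>,
  coefficient by coefficient; the shift \<open>pCons 0\<close> corresponds to one more application
  of \<open>K\<close>.\<close>

lemma op_poly_linear_factor:
  fixes K :: "'a::complex_banach \<Rightarrow> 'a"
  assumes "bounded_clinear K"
  shows "op_poly ([:- z, 1:] * q) K x = K (op_poly q K x) - z *\<^sub>C op_poly q K x"
proof -
  let ?N = "degree q"
  have "op_poly ([:- z, 1:] * q) K x
      = (\<Sum>i\<le>Suc ?N. coeff ([:- z, 1:] * q) i *\<^sub>C (K ^^ i) x)"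
    using degree_mult_le[of "[:- z, 1:]" q] by (intro op_poly_altdef) simp
  also have "\<dots> = (\<Sum>i\<le>Suc ?N. coeff (pCons 0 q) i *\<^sub>C (K ^^ i) x)
      - (\<Sum>i\<le>Suc ?N. z *\<^sub>C coeff q i *\<^sub>C (K ^^ i) x)"
    by (simp only: sum_subtractf[symmetric])
       (intro sum.cong, auto simp: scaleC_diff_left scaleC_scaleC scaleC_add_left scaleC_minus_left)
  \<comment> \<open>The term at index 0 is zero; reindexing the others by one pulls a factor
    \<open>K\<close> out of each.\<close>
  also have "(\<Sum>i\<le>Suc ?N. coeff (pCons 0 q) i *\<^sub>C (K ^^ i) x) = K (op_poly q K x)"
    by (simp add: sum.atMost_Suc_shift op_poly_def scaleC_zero_left bounded_clinear_sum[OF assms]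
        bounded_clinear_scaleC_commute[OF assms] del: sum.atMost_Suc)
  also have "(\<Sum>i\<le>Suc ?N. z *\<^sub>C coeff q i *\<^sub>C (K ^^ i) x) = z *\<^sub>C op_poly q K x"
    by (simp only: op_poly_altdef[OF le_SucI[OF order_refl]]
        bounded_clinear_sum[OF bounded_clinear_scaleC])
  finally show ?thesis .
qed

lemma op_poly_commute:
  fixes K S :: "'a::complex_banach \<Rightarrow> 'a"
  assumes "bounded_clinear S" and "\<And>x. S (K x) = K (S x)"
  shows "S (op_poly p K x) = op_poly p K (S x)"
proof -
  have "S ((K ^^ i) x) = (K ^^ i) (S x)" for i
    by (induction i) (simp_all add: assms(2))
  then show ?thesis
    by (simp add: op_poly_def bounded_clinear_sum[OF assms(1)]
        bounded_clinear_scaleC_commute[OF assms(1)])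
qed

section \<open>Stability of analyticity and of convergence to zero under operators and
  translations\<close>

lemma analytic_fun_on_bounded_clinear:
  assumes "bounded_clinear A" and "analytic_fun_on f U"
  shows "analytic_fun_on (\<lambda>z. A (f z)) U"
  unfolding analytic_fun_on_def
proof
  fix z assume "z \<in> U"
  then obtain D where "(f has_derivative (\<lambda>h. h *\<^sub>C D)) (at z)"
    using assms(2) by (auto simp: analytic_fun_on_def)
  then have "((\<lambda>z. A (f z)) has_derivative (\<lambda>h. A (h *\<^sub>C D))) (at z)"
    by (rule bounded_linear.has_derivative[OF bounded_clinear_imp_bounded_linear[OF assms(1)]])
  then show "\<exists>D. ((\<lambda>z. A (f z)) has_derivative (\<lambda>h. h *\<^sub>C D)) (at z)"
    by (auto simp: bounded_clinear_scaleC_commute[OF assms(1)])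
qed

lemma analytic_fun_on_translate:
  assumes "analytic_fun_on f U"
  shows "analytic_fun_on (\<lambda>z. f (z + a)) ((\<lambda>z. z - a) ` U)"
  unfolding analytic_fun_on_def
proof
  fix z assume "z \<in> (\<lambda>z. z - a) ` U"
  then have "z + a \<in> U" by auto
  then obtain D where "(f has_derivative (\<lambda>h. h *\<^sub>C D)) (at (z + a))"
    using assms by (auto simp: analytic_fun_on_def)
  moreover have "((\<lambda>z. z + a) has_derivative (\<lambda>h. h)) (at z)"
    by (auto intro!: derivative_eq_intros)
  ultimately have "((\<lambda>z. f (z + a)) has_derivative (\<lambda>h. h *\<^sub>C D)) (at z)"
    by (rule has_derivative_compose[rotated])
  then show "\<exists>D. ((\<lambda>z. f (z + a)) has_derivative (\<lambda>h. h *\<^sub>C D)) (at z)" ..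
qed

lemma tendsto_zero_in_O_bounded_clinear:
  assumes "bounded_clinear A" and "tendsto_zero_in_O U f"
  shows "tendsto_zero_in_O U (\<lambda>n z. A (f n z))"
  using assms linear_0[OF bounded_linear.linear[OF bounded_clinear_imp_bounded_linear[OF assms(1)]]]
    bounded_linear.uniform_limit[OF bounded_clinear_imp_bounded_linear[OF assms(1)], where g = f and l = "\<lambda>z. 0"]
  by (auto simp: tendsto_zero_in_O_def)

lemma tendsto_zero_in_O_diff:
  assumes "tendsto_zero_in_O U f" and "tendsto_zero_in_O U g"
  shows "tendsto_zero_in_O U (\<lambda>n z. f n z - g n z)"
  using assms uniform_limit_minus[where f = f and l = "\<lambda>z. 0" and g = g and m = "\<lambda>z. 0"]
  by (auto simp: tendsto_zero_in_O_def)

text \<open>Translation by \<open>a\<close> carries compact subsets of the shifted set to compact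
  subsets of \<open>U\<close>, and uniform bounds are carried along.\<close>

lemma tendsto_zero_in_O_translate:
  assumes "tendsto_zero_in_O U f"
  shows "tendsto_zero_in_O ((\<lambda>z. z - a) ` U) (\<lambda>n z. f n (z + a))"
  unfolding tendsto_zero_in_O_def
proof (intro allI impI)
  fix C assume C: "compact C \<and> C \<subseteq> (\<lambda>z. z - a) ` U"
  then have "compact ((\<lambda>z. z + a) ` C) \<and> (\<lambda>z. z + a) ` C \<subseteq> U"
    by (auto intro!: compact_continuous_image continuous_intros)
  then have "uniform_limit ((\<lambda>z. z + a) ` C) f (\<lambda>z. 0) sequentially"
    using assms by (auto simp: tendsto_zero_in_O_def)
  then show "uniform_limit C (\<lambda>n z. f n (z + a)) (\<lambda>z. 0) sequentially"
    by (auto simp: uniform_limit_iff)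
qed

section \<open>Property (\<beta>) with an explicit radius\<close>

definition bishop_beta_radius :: "('a::complex_banach \<Rightarrow> 'a) \<Rightarrow> complex \<Rightarrow> real \<Rightarrow> bool" where
  "bishop_beta_radius T z0 v \<longleftrightarrow>
     (\<forall>U f. open U \<and> U \<subseteq> ball z0 v \<and> (\<forall>n. analytic_fun_on (f n) U) \<and>
        tendsto_zero_in_O U (\<lambda>n z. T (f n z) - z *\<^sub>C f n z)
        \<longrightarrow> tendsto_zero_in_O U f)"

lemma bishop_beta_at_iff_radius: "bishop_beta_at T z0 \<longleftrightarrow> (\<exists>v>0. bishop_beta_radius T z0 v)"
  by (simp add: bishop_beta_at_def bishop_beta_radius_def)

lemma bishop_beta_radius_mono:
  assumes "bishop_beta_radius T z0 v" and "u \<le> v"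
  shows "bishop_beta_radius T z0 u"
  using assms subset_ball[OF assms(2), of z0] unfolding bishop_beta_radius_def by blast

text \<open>Finitely many positive radii have a positive minimum, and shrinking a disc only removes
  open sets to be tested. One disc then serves all roots of a polynomial.\<close>

lemma finite_common_radius:
  assumes "finite A" and "\<And>z. z \<in> A \<Longrightarrow> bishop_beta_at T (g z)"
  shows "\<exists>v>0. \<forall>z\<in>A. bishop_beta_radius T (g z) v"
  using assms
proof (induction A rule: finite_induct)
  case empty
  then show ?case by (auto intro: exI[of _ 1])
next
  case (insert a A)
  obtain u v where "u > 0" "bishop_beta_radius T (g a) u"
    and "v > 0" "\<forall>z\<in>A. bishop_beta_radius T (g z) v"
    using insert by (metis bishop_beta_at_iff_radius insertCI)
  then have "min u v > 0 \<and> (\<forall>z\<in>insert a A. bishop_beta_radius T (g z) (min u v))"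
    by (auto intro: bishop_beta_radius_mono)
  then show ?case by blast
qed

text \<open>Substituting \<open>z + a\<close> for \<open>z\<close> turns the factor
  \<open>z - a\<close> into \<open>z\<close> and moves the disc about \<open>w\<close> to the disc
  about \<open>w - a\<close>, where the hypothesis on \<open>T\<close> applies.\<close>

lemma bishop_beta_radius_shifted:
  assumes "bishop_beta_radius T (w - a) v"
    and "open U" and "U \<subseteq> ball w v" and "\<And>n. analytic_fun_on (f n) U"
    and "tendsto_zero_in_O U (\<lambda>n z. T (f n z) - (z - a) *\<^sub>C f n z)"
  shows "tendsto_zero_in_O U f"
proof -
  let ?U = "(\<lambda>z. z - a) ` U" and ?f = "\<lambda>n z. f n (z + a)"
  have "open ?U"
    using open_translation[OF assms(2), of "- a"] by (simp add: image_def algebra_simps)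
  moreover have "?U \<subseteq> ball (w - a) v"
    using assms(3) by (auto simp: dist_norm)
  moreover have "\<forall>n. analytic_fun_on (?f n) ?U"
    by (intro allI analytic_fun_on_translate assms(4))
  moreover have "tendsto_zero_in_O ?U (\<lambda>n z. T (?f n z) - z *\<^sub>C ?f n z)"
    using tendsto_zero_in_O_translate[OF assms(5), of a] by simp
  ultimately have "tendsto_zero_in_O ?U ?f"
    using assms(1) bishop_beta_radius_def[of T "w - a" v] by presburger
  \<comment> \<open>The opposite translation returns to \<open>U\<close> and
    \<open>f\<close>.\<close>
  from tendsto_zero_in_O_translate[OF this, of "- a"] show ?thesis
    by (simp add: image_image)
qed

text \<open>The induction varies \<open>p\<close> alone: \<open>U\<close>, \<open>f\<close> and the
  radius \<open>v\<close> stay fixed, which is why \<open>v\<close> must be common to all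
  roots.\<close>

lemma tendsto_zero_in_O_if_op_poly:
  fixes T K :: "'a::complex_banach \<Rightarrow> 'a"
  assumes T: "bounded_clinear T" and K: "bounded_clinear K" and comm: "\<And>x. T (K x) = K (T x)"
    and U: "open U" "U \<subseteq> ball w v" and f: "\<And>n. analytic_fun_on (f n) U"
    and lim: "tendsto_zero_in_O U (\<lambda>n z. T (f n z) + c *\<^sub>C K (f n z) - z *\<^sub>C f n z)"
    and "p \<noteq> 0" and "\<And>z. poly p z = 0 \<Longrightarrow> bishop_beta_radius T (w - c * z) v"
    and "tendsto_zero_in_O U (\<lambda>n z. op_poly p K (f n z))"
  shows "tendsto_zero_in_O U f"
  using assms(8-10)
proof (induction "degree p" arbitrary: p)
  case 0
  then obtain b where p: "p = [:b:]" "b \<noteq> 0"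
    by (metis degree_eq_zeroE pCons_eq_0_iff)
  \<comment> \<open>A nonzero constant polynomial acts as the invertible scalar
    \<open>b\<close>.\<close>
  have "tendsto_zero_in_O U (\<lambda>n z. (1 / b) *\<^sub>C op_poly p K (f n z))"
    by (intro tendsto_zero_in_O_bounded_clinear[OF bounded_clinear_scaleC] 0)
  then show ?case
    using p by (simp add: op_poly_def scaleC_scaleC scaleC_one)
next
  case (Suc d)
  then obtain a where "poly p a = 0"
    using fundamental_theorem_of_algebra[of p] by (auto simp: constant_degree)
  then obtain q where p: "p = [:- a, 1:] * q"
    by (auto simp: poly_eq_0_iff_dvd)
  have "q \<noteq> 0"
    using p Suc by auto
  have "degree p = degree [:- a, 1:] + degree q"
    unfolding p using \<open>q \<noteq> 0\<close> by (intro degree_mult_eq) auto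
  then have "d = degree q"
    using Suc by simp
  let ?Q = "op_poly q K"
  have Q: "bounded_clinear ?Q"
    by (rule bounded_clinear_op_poly[OF K])
  have TQ: "T (?Q x) = ?Q (T x)" and KQ: "K (?Q x) = ?Q (K x)" for x
    by (simp_all add: op_poly_commute T K comm)
  \<comment> \<open>\<open>?Q\<close> commutes with \<open>T\<close>, \<open>K\<close> and scalars,
    so applying it to \<open>lim\<close> gives the same relation for the functions
    \<open>?Q (f n z)\<close>.\<close>
  have "tendsto_zero_in_O U (\<lambda>n z. T (?Q (f n z)) + c *\<^sub>C K (?Q (f n z)) - z *\<^sub>C ?Q (f n z))"
    using tendsto_zero_in_O_bounded_clinear[OF Q lim]
    by (simp add: TQ KQ bounded_clinear_add[OF Q] bounded_clinear_diff[OF Q]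
        bounded_clinear_scaleC_commute[OF Q])
  moreover have "tendsto_zero_in_O U (\<lambda>n z. c *\<^sub>C (K (?Q (f n z)) - a *\<^sub>C ?Q (f n z)))"
    using tendsto_zero_in_O_bounded_clinear[OF bounded_clinear_scaleC[of c] Suc.prems(3)]
    by (simp only: p op_poly_linear_factor[OF K])
  ultimately have
    "tendsto_zero_in_O U (\<lambda>n z. T (?Q (f n z)) + c *\<^sub>C K (?Q (f n z)) - z *\<^sub>C ?Q (f n z)
       - c *\<^sub>C (K (?Q (f n z)) - a *\<^sub>C ?Q (f n z)))"
    by (rule tendsto_zero_in_O_diff)
  \<comment> \<open>The terms with \<open>K\<close> cancel, so only \<open>T\<close> with a shifted
    spectral parameter remains.\<close>
  then have "tendsto_zero_in_O U (\<lambda>n z. T (?Q (f n z)) - (z - c * a) *\<^sub>C ?Q (f n z))"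
    by (simp add: scaleC_diff_right scaleC_diff_left scaleC_scaleC algebra_simps)
  then have "tendsto_zero_in_O U (\<lambda>n z. ?Q (f n z))"
    by (rule bishop_beta_radius_shifted[OF Suc.prems(2)[OF \<open>poly p a = 0\<close>] U
          analytic_fun_on_bounded_clinear[OF Q f]])
  \<comment> \<open>The roots of \<open>q\<close> are roots of \<open>p\<close>, so the radius
    hypothesis passes to \<open>q\<close>.\<close>
  then show ?case
    using Suc.hyps(1)[OF \<open>d = degree q\<close> \<open>q \<noteq> 0\<close>] Suc.prems(2) by (simp add: p)
qed

text \<open>Since \<open>op_poly p K\<close> is zero, its values on any sequence tend to zero
  trivially, which starts the removal of factors for every admissible \<open>f\<close>.\<close>

lemma bishop_beta_at_add_scaleC:
  fixes T K :: "'a::complex_banach \<Rightarrow> 'a"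
  assumes "bounded_clinear T" and "bounded_clinear K" and "\<And>x. T (K x) = K (T x)"
    and "p \<noteq> 0" and zero: "op_poly p K = (\<lambda>x. 0)"
    and roots: "\<And>z. poly p z = 0 \<Longrightarrow> bishop_beta_at T (w - c * z)"
  shows "bishop_beta_at (\<lambda>x. T x + c *\<^sub>C K x) w"
proof -
  have "\<exists>v>0. \<forall>z\<in>{z. poly p z = 0}. bishop_beta_radius T (w - c * z) v"
    by (intro finite_common_radius poly_roots_finite[OF \<open>p \<noteq> 0\<close>] roots) simp
  then obtain v where "v > 0" and v: "\<And>z. poly p z = 0 \<Longrightarrow> bishop_beta_radius T (w - c * z) v"
    by blast
  have "bishop_beta_radius (\<lambda>x. T x + c *\<^sub>C K x) w v"
    unfolding bishop_beta_radius_def[of "\<lambda>x. T x + c *\<^sub>C K x"]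
  proof (intro allI impI, elim conjE)
    fix U and f :: "nat \<Rightarrow> complex \<Rightarrow> 'a"
    assume U: "open U" "U \<subseteq> ball w v" and f: "\<forall>n. analytic_fun_on (f n) U"
      and lim: "tendsto_zero_in_O U (\<lambda>n z. T (f n z) + c *\<^sub>C K (f n z) - z *\<^sub>C f n z)"
    have "tendsto_zero_in_O U (\<lambda>n z. op_poly p K (f n z))"
      by (simp add: zero tendsto_zero_in_O_def uniform_limit_iff)
    then show "tendsto_zero_in_O U f"
      using f by (intro tendsto_zero_in_O_if_op_poly[OF assms(1-3) U _ lim \<open>p \<noteq> 0\<close> v]) auto
  qed
  with \<open>v > 0\<close> show ?thesis
    unfolding bishop_beta_at_iff_radius by blast
qed

theorem theorem2p5:
  fixes T K :: "'a::complex_banach \<Rightarrow> 'a"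
  assumes "bounded_clinear T" and "bounded_clinear K"
    and "algebraic_op K"
    and "T \<circ> K = K \<circ> T"
  shows "(\<forall>p. p \<noteq> 0 \<and> op_poly p K = (\<lambda>x. 0) \<and> (\<forall>z. poly p z = 0 \<longrightarrow> bishop_beta_at T z)
            \<longrightarrow> bishop_beta_at (\<lambda>x. T x - K x) 0)
       \<and> (bishop_beta T \<longrightarrow> bishop_beta (\<lambda>x. T x + K x))"
proof (intro conjI allI impI)
  have comm: "T (K x) = K (T x)" for x
    using fun_cong[OF assms(4), of x] by simp
  show "bishop_beta_at (\<lambda>x. T x - K x) 0"
    if p: "p \<noteq> 0 \<and> op_poly p K = (\<lambda>x. 0) \<and> (\<forall>z. poly p z = 0 \<longrightarrow> bishop_beta_at T z)" for p
  proof -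
    \<comment> \<open>For \<open>c = - 1\<close> and \<open>w = 0\<close> the point
      \<open>w - c * z\<close> is the root \<open>z\<close> itself; \<open>c = 1\<close> would ask
      for property (\<beta>) at \<open>- z\<close> instead.\<close>
    have "bishop_beta_at (\<lambda>x. T x + (- 1) *\<^sub>C K x) 0"
      by (rule bishop_beta_at_add_scaleC[OF assms(1,2) comm, of p]) (use p in simp_all)
    then show ?thesis
      by (simp add: scaleC_minus_left scaleC_one)
  qed
  show "bishop_beta (\<lambda>x. T x + K x)" if T: "bishop_beta T"
    unfolding bishop_beta_def
  proof
    fix w
    obtain p where p: "p \<noteq> 0" "op_poly p K = (\<lambda>x. 0)"
      using assms(3) unfolding algebraic_op_def by blast
    \<comment> \<open>Here the points are \<open>w - z\<close> with \<open>z\<close> a root of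
      \<open>p\<close>; the global hypothesis on \<open>T\<close> covers them for every
      \<open>w\<close>.\<close>
    have "bishop_beta_at (\<lambda>x. T x + 1 *\<^sub>C K x) w"
      by (rule bishop_beta_at_add_scaleC[OF assms(1,2) comm p T[unfolded bishop_beta_def, rule_format]])
    then show "bishop_beta_at (\<lambda>x. T x + K x) w"
      by (simp add: scaleC_one)
  qed
qed

end
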